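(* (Completeness for Sequents.) For finite sets of formulas $\Gamma,\Delta$: if $\vDash\Gamma\Rightarrow\Delta$ (i.e. for every structure $\mathfrak{A}$ and every $s\colon V\to|\mathfrak{A}|$, if $\mathfrak{A}$ satisfies every member of $\Gamma$ with $s$ then it satisfies some member of $\Delta$ with $s$), then $\Gamma\Rightarrow\Delta$ is derivable in $\mathbf{CPF}^I$.
   Context: Language $\mathcal{L}$: first-order, with variables $V$ (which may occur free), individual constants, function symbols, predicate symbols, identity $=$, a one-place existence predicate $\exists!$, connectives $\neg,\rightarrow$ (others defined), quantifier $\forall$, and the binary quantifier $I$: if $A,B$ are formulas and $x$ a variable, $Ix[A,B]$ is a formula binding $x$ in $A$ and $B$. $A_t^x$ is substitution of $t$ for $x$ ($t$ free for $x$). Sequents $\Gamma\Rightarrow\Delta$ have finite sets of formulas on each side. The system $\mathbf{CPF}^I$ has axioms $A\Rightarrow A$ and the rules: Cut; weakening and contraction; $(L\neg)$: $\Gamma\Rightarrow\Delta,A$ / $\neg A,\Gamma\Rightarrow\Delta$; $(R\neg)$: $A,\Gamma\Rightarrow\Delta$ / $\Gamma\Rightarrow\Delta,\neg A$; $(L\rightarrow)$: $\Gamma\Rightarrow\Delta,A$ and $B,\Gamma\Rightarrow\Delta$ / $A\rightarrow B,\Gamma\Rightarrow\Delta$; $(R\rightarrow)$: $A,\Gamma\Rightarrow\Delta,B$ / $\Gamma\Rightarrow\Delta,A\rightarrow B$; $(L\forall)$: $A_t^x,\Gamma\Rightarrow\Delta$ / $\exists!t,\forall xA,\Gamma\Rightarrow\Delta$;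 $(R\forall)$: $\exists!a,\Gamma\Rightarrow\Delta,A_a^x$ / $\Gamma\Rightarrow\Delta,\forall xA$; identity: $A_{t_2}^x,\Gamma\Rightarrow\Delta$ / $t_1=t_2,A_{t_1}^x,\Gamma\Rightarrow\Delta$ ($A$ atomic), and $t=t,\Gamma\Rightarrow\Delta$ / $\Gamma\Rightarrow\Delta$; $(RI)$: $\Gamma\Rightarrow\Delta,A_t^x$, $\Gamma\Rightarrow\Delta,B_t^x$, $A_a^x,\Gamma\Rightarrow\Delta,a=t$ / $\Gamma\Rightarrow\Delta,Ix[A,B]$; $(LI^1)$: $A_a^x,B_a^x,\Gamma\Rightarrow\Delta$ / $Ix[A,B],\Gamma\Rightarrow\Delta$; $(LI^2)$: $\Gamma\Rightarrow\Delta,A_{t_1}^x$, $\Gamma\Rightarrow\Delta,A_{t_2}^x$, $\Gamma\Rightarrow\Delta,C_{t_2}^x$ / $Ix[A,B],\Gamma\Rightarrow\Delta,C_{t_1}^x$ ($C$ atomic). In $(R\forall)$, $(RI)$, $(LI^1)$ the eigen-term $a$ must not occur in the conclusion. A structure $\mathfrak{A}$ consists of a non-empty domain $|\mathfrak{A}|$, an inner domain $|\mathfrak{A}^\forall|\subseteq|\mathfrak{A}|$ (possibly empty), which is also the interpretation of $\exists!$, relations $P^\mathfrak{A}\subseteq|\mathfrak{A}|^n$, elements $c^\mathfrak{A}\in|\mathfrak{A}|$, operations $f^\mathfrak{A}\colon|\mathfrak{A}|^n\to|\mathfrak{A}|$. For $s\colon V\to|\mathfrak{A}|$, $\overline{s}$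 is its extension to terms and $s(x|d)$ is $s$ modified to send $x$ to $d$. Satisfaction: $\vDash_\mathfrak{A}t_1=t_2[s]$ iff $\overline{s}(t_1)=\overline{s}(t_2)$; $\vDash_\mathfrak{A}\exists!t[s]$ iff $\overline{s}(t)\in|\mathfrak{A}^\forall|$; atomic $Pt_1\dots t_n$ as usual; $\neg,\rightarrow$ classically; $\vDash_\mathfrak{A}\forall xA[s]$ iff $\vDash_\mathfrak{A}A[s(x|d)]$ for every $d\in|\mathfrak{A}^\forall|$; $\vDash_\mathfrak{A}Ix[A,B][s]$ iff there is $d\in|\mathfrak{A}|$ with $\vDash_\mathfrak{A}A[s(x|d)]$, no other $e\in|\mathfrak{A}|$ with $\vDash_\mathfrak{A}A[s(x|e)]$, and $\vDash_\mathfrak{A}B[s(x|d)]$. *)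

theory Defs
  imports Main
begin

text \<open>
  A language is given by its individual constants and by partial maps assigning an arity to each
  of its function and predicate symbols. Variables are natural numbers.
\<close>

record ('c, 'f, 'p) lang =
  csym :: "'c set"
  farity :: "'f \<Rightarrow> nat option"
  parity :: "'p \<Rightarrow> nat option"

datatype ('c, 'f) tm = Var nat | Con 'c | Fun 'f "('c, 'f) tm list"

text \<open>\<open>Exi t\<close> is the existence predicate applied to \<open>t\<close>; \<open>Iota x A B\<close> is \<open>Ix[A,B]\<close>.\<close>

datatype ('c, 'f, 'p) fm =
    Pred 'p "('c, 'f) tm list"
  | Eq "('c, 'f) tm" "('c, 'f) tm"
  | Exi "('c, 'f) tm"
  | Neg "('c, 'f, 'p) fm"
  | Imp "('c, 'f, 'p) fm" "('c, 'f, 'p) fm"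
  | All nat "('c, 'f, 'p) fm"
  | Iota nat "('c, 'f, 'p) fm" "('c, 'f, 'p) fm"

fun is_tm :: "('c, 'f, 'p) lang \<Rightarrow> ('c, 'f) tm \<Rightarrow> bool" where
  "is_tm L (Var x) \<longleftrightarrow> True"
| "is_tm L (Con c) \<longleftrightarrow> c \<in> csym L"
| "is_tm L (Fun f ts) \<longleftrightarrow> farity L f = Some (length ts) \<and> (\<forall>t \<in> set ts. is_tm L t)"

fun is_fm :: "('c, 'f, 'p) lang \<Rightarrow> ('c, 'f, 'p) fm \<Rightarrow> bool" where
  "is_fm L (Pred P ts) \<longleftrightarrow> parity L P = Some (length ts) \<and> (\<forall>t \<in> set ts. is_tm L t)"
| "is_fm L (Eq t u) \<longleftrightarrow> is_tm L t \<and> is_tm L u"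
| "is_fm L (Exi t) \<longleftrightarrow> is_tm L t"
| "is_fm L (Neg A) \<longleftrightarrow> is_fm L A"
| "is_fm L (Imp A B) \<longleftrightarrow> is_fm L A \<and> is_fm L B"
| "is_fm L (All x A) \<longleftrightarrow> is_fm L A"
| "is_fm L (Iota x A B) \<longleftrightarrow> is_fm L A \<and> is_fm L B"

fun atomic :: "('c, 'f, 'p) fm \<Rightarrow> bool" where
  "atomic (Pred P ts) \<longleftrightarrow> True"
| "atomic (Eq t u) \<longleftrightarrow> True"
| "atomic (Exi t) \<longleftrightarrow> True"
| "atomic _ \<longleftrightarrow> False"

fun subterms :: "('c, 'f) tm \<Rightarrow> ('c, 'f) tm set" where
  "subterms (Var x) = {Var x}"
| "subterms (Con c) = {Con c}"
| "subterms (Fun f ts) = insert (Fun f ts) (\<Union>t \<in> set ts. subterms t)"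

text \<open>
  Occurrence is meant literally: it covers free and bound occurrences of a variable as well as its
  occurrence next to a quantifier.
\<close>

fun occurs :: "('c, 'f) tm \<Rightarrow> ('c, 'f, 'p) fm \<Rightarrow> bool" where
  "occurs a (Pred P ts) \<longleftrightarrow> (\<exists>t \<in> set ts. a \<in> subterms t)"
| "occurs a (Eq t u) \<longleftrightarrow> a \<in> subterms t \<or> a \<in> subterms u"
| "occurs a (Exi t) \<longleftrightarrow> a \<in> subterms t"
| "occurs a (Neg A) \<longleftrightarrow> occurs a A"
| "occurs a (Imp A B) \<longleftrightarrow> occurs a A \<or> occurs a B"
| "occurs a (All x A) \<longleftrightarrow> a = Var x \<or> occurs a A"
| "occurs a (Iota x A B) \<longleftrightarrow> a = Var x \<or> occurs a A \<or> occurs a B"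

fun free_in :: "nat \<Rightarrow> ('c, 'f, 'p) fm \<Rightarrow> bool" where
  "free_in x (Pred P ts) \<longleftrightarrow> (\<exists>t \<in> set ts. Var x \<in> subterms t)"
| "free_in x (Eq t u) \<longleftrightarrow> Var x \<in> subterms t \<or> Var x \<in> subterms u"
| "free_in x (Exi t) \<longleftrightarrow> Var x \<in> subterms t"
| "free_in x (Neg A) \<longleftrightarrow> free_in x A"
| "free_in x (Imp A B) \<longleftrightarrow> free_in x A \<or> free_in x B"
| "free_in x (All y A) \<longleftrightarrow> x \<noteq> y \<and> free_in x A"
| "free_in x (Iota y A B) \<longleftrightarrow> x \<noteq> y \<and> (free_in x A \<or> free_in x B)"

text \<open>
  \<open>free_for t x A\<close>: no free occurrence of \<open>x\<close> in \<open>A\<close> lies in the scope of a quantifier that binds a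
  variable of \<open>t\<close>.
\<close>

fun free_for :: "('c, 'f) tm \<Rightarrow> nat \<Rightarrow> ('c, 'f, 'p) fm \<Rightarrow> bool" where
  "free_for t x (Pred P ts) \<longleftrightarrow> True"
| "free_for t x (Eq u v) \<longleftrightarrow> True"
| "free_for t x (Exi u) \<longleftrightarrow> True"
| "free_for t x (Neg A) \<longleftrightarrow> free_for t x A"
| "free_for t x (Imp A B) \<longleftrightarrow> free_for t x A \<and> free_for t x B"
| "free_for t x (All y A) \<longleftrightarrow>
     \<not> free_in x (All y A) \<or> (Var y \<notin> subterms t \<and> free_for t x A)"
| "free_for t x (Iota y A B) \<longleftrightarrow>
     \<not> free_in x (Iota y A B) \<or> (Var y \<notin> subterms t \<and> free_for t x A \<and> free_for t x B)"

fun subst_tm :: "('c, 'f) tm \<Rightarrow> nat \<Rightarrow> ('c, 'f) tm \<Rightarrow> ('c, 'f) tm" where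
  "subst_tm (Var y) x t = (if y = x then t else Var y)"
| "subst_tm (Con c) x t = Con c"
| "subst_tm (Fun f us) x t = Fun f (map (\<lambda>u. subst_tm u x t) us)"

text \<open>
  \<open>subst A x t\<close> replaces the free occurrences of \<open>x\<close> in \<open>A\<close> by \<open>t\<close>. It does not rename bound
  variables and is to be used only when \<open>t\<close> is free for \<open>x\<close> in \<open>A\<close>.
\<close>

fun subst :: "('c, 'f, 'p) fm \<Rightarrow> nat \<Rightarrow> ('c, 'f) tm \<Rightarrow> ('c, 'f, 'p) fm" where
  "subst (Pred P us) x t = Pred P (map (\<lambda>u. subst_tm u x t) us)"
| "subst (Eq u v) x t = Eq (subst_tm u x t) (subst_tm v x t)"
| "subst (Exi u) x t = Exi (subst_tm u x t)"
| "subst (Neg A) x t = Neg (subst A x t)"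
| "subst (Imp A B) x t = Imp (subst A x t) (subst B x t)"
| "subst (All y A) x t = (if y = x then All y A else All y (subst A x t))"
| "subst (Iota y A B) x t =
     (if y = x then Iota y A B else Iota y (subst A x t) (subst B x t))"

text \<open>
  An eigen-term is a variable or an individual constant; with compound terms the rules would be
  unsound.
\<close>

definition eigen :: "('c, 'f) tm \<Rightarrow> ('c, 'f, 'p) fm set \<Rightarrow> bool" where
  "eigen a S \<longleftrightarrow> ((\<exists>y. a = Var y) \<or> (\<exists>c. a = Con c)) \<and> (\<forall>F \<in> S. \<not> occurs a F)"

text \<open>
  Since sequents consist of sets, contraction is built in. The conditions \<open>is_tm\<close> and \<open>is_fm\<close> are
  stated where membership in the language is not inherited from the premises. No \<open>free_for\<close>
  condition is needed for eigen-terms (they do not occur in the conclusion, hence not in the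
  formula substituted into) nor for atomic formulas. In \<open>RI\<close> the eigen-term must also not occur in
  \<open>t\<close>: taking \<open>t\<close> to be \<open>a\<close> itself would make the third premise trivial and the rule unsound.
\<close>

inductive derivable ::
  "('c, 'f, 'p) lang \<Rightarrow> ('c, 'f, 'p) fm set \<Rightarrow> ('c, 'f, 'p) fm set \<Rightarrow> bool"
  for L :: "('c, 'f, 'p) lang"
where
  Ax: "is_fm L A \<Longrightarrow> derivable L {A} {A}"
| Cut: "derivable L \<Gamma> (insert A \<Delta>) \<Longrightarrow> derivable L (insert A \<Gamma>') \<Delta>' \<Longrightarrow>
    derivable L (\<Gamma> \<union> \<Gamma>') (\<Delta> \<union> \<Delta>')"
| LW: "derivable L \<Gamma> \<Delta> \<Longrightarrow> is_fm L A \<Longrightarrow> derivable L (insert A \<Gamma>) \<Delta>"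
| RW: "derivable L \<Gamma> \<Delta> \<Longrightarrow> is_fm L A \<Longrightarrow> derivable L \<Gamma> (insert A \<Delta>)"
| LNeg: "derivable L \<Gamma> (insert A \<Delta>) \<Longrightarrow> derivable L (insert (Neg A) \<Gamma>) \<Delta>"
| RNeg: "derivable L (insert A \<Gamma>) \<Delta> \<Longrightarrow> derivable L \<Gamma> (insert (Neg A) \<Delta>)"
| LImp: "derivable L \<Gamma> (insert A \<Delta>) \<Longrightarrow> derivable L (insert B \<Gamma>) \<Delta> \<Longrightarrow>
    derivable L (insert (Imp A B) \<Gamma>) \<Delta>"
| RImp: "derivable L (insert A \<Gamma>) (insert B \<Delta>) \<Longrightarrow> derivable L \<Gamma> (insert (Imp A B) \<Delta>)"
| LAll: "derivable L (insert (subst A x t) \<Gamma>) \<Delta> \<Longrightarrow> is_tm L t \<Longrightarrow> free_for t x A \<Longrightarrow>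
    derivable L (insert (Exi t) (insert (All x A) \<Gamma>)) \<Delta>"
| RAll: "derivable L (insert (Exi a) \<Gamma>) (insert (subst A x a) \<Delta>) \<Longrightarrow>
    eigen a (\<Gamma> \<union> insert (All x A) \<Delta>) \<Longrightarrow>
    derivable L \<Gamma> (insert (All x A) \<Delta>)"
| LEq: "derivable L (insert (subst A x t\<^sub>2) \<Gamma>) \<Delta> \<Longrightarrow> atomic A \<Longrightarrow> is_tm L t\<^sub>1 \<Longrightarrow> is_tm L t\<^sub>2 \<Longrightarrow>
    derivable L (insert (Eq t\<^sub>1 t\<^sub>2) (insert (subst A x t\<^sub>1) \<Gamma>)) \<Delta>"
| EqRefl: "derivable L (insert (Eq t t) \<Gamma>) \<Delta> \<Longrightarrow> derivable L \<Gamma> \<Delta>"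
| RI: "derivable L \<Gamma> (insert (subst A x t) \<Delta>) \<Longrightarrow> derivable L \<Gamma> (insert (subst B x t) \<Delta>) \<Longrightarrow>
    derivable L (insert (subst A x a) \<Gamma>) (insert (Eq a t) \<Delta>) \<Longrightarrow>
    free_for t x A \<Longrightarrow> free_for t x B \<Longrightarrow>
    eigen a (\<Gamma> \<union> insert (Iota x A B) \<Delta>) \<Longrightarrow> a \<notin> subterms t \<Longrightarrow>
    derivable L \<Gamma> (insert (Iota x A B) \<Delta>)"
| LI1: "derivable L (insert (subst A x a) (insert (subst B x a) \<Gamma>)) \<Delta> \<Longrightarrow>
    eigen a (insert (Iota x A B) \<Gamma> \<union> \<Delta>) \<Longrightarrow>
    derivable L (insert (Iota x A B) \<Gamma>) \<Delta>"
| LI2: "derivable L \<Gamma> (insert (subst A x t\<^sub>1) \<Delta>) \<Longrightarrow> derivable L \<Gamma> (insert (subst A x t\<^sub>2) \<Delta>) \<Longrightarrow>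
    derivable L \<Gamma> (insert (subst C y t\<^sub>2) \<Delta>) \<Longrightarrow>
    atomic C \<Longrightarrow> free_for t\<^sub>1 x A \<Longrightarrow> free_for t\<^sub>2 x A \<Longrightarrow>
    is_tm L t\<^sub>1 \<Longrightarrow> is_tm L t\<^sub>2 \<Longrightarrow> is_fm L B \<Longrightarrow>
    derivable L (insert (Iota x A B) \<Gamma>) (insert (subst C y t\<^sub>1) \<Delta>)"

record ('u, 'c, 'f, 'p) struc =
  Dom :: "'u set"
  Inner :: "'u set"
  ConI :: "'c \<Rightarrow> 'u"
  FunI :: "'f \<Rightarrow> 'u list \<Rightarrow> 'u"
  PredI :: "'p \<Rightarrow> 'u list set"

definition is_struc :: "('c, 'f, 'p) lang \<Rightarrow> ('u, 'c, 'f, 'p) struc \<Rightarrow> bool" where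
  "is_struc L M \<longleftrightarrow>
     Dom M \<noteq> {} \<and> Inner M \<subseteq> Dom M \<and>
     (\<forall>c \<in> csym L. ConI M c \<in> Dom M) \<and>
     (\<forall>f ds. farity L f = Some (length ds) \<and> set ds \<subseteq> Dom M \<longrightarrow> FunI M f ds \<in> Dom M) \<and>
     (\<forall>P n. parity L P = Some n \<longrightarrow> PredI M P \<subseteq> {ds. length ds = n \<and> set ds \<subseteq> Dom M})"

fun val :: "('u, 'c, 'f, 'p) struc \<Rightarrow> (nat \<Rightarrow> 'u) \<Rightarrow> ('c, 'f) tm \<Rightarrow> 'u" where
  "val M s (Var x) = s x"
| "val M s (Con c) = ConI M c"
| "val M s (Fun f ts) = FunI M f (map (val M s) ts)"

fun sat :: "('u, 'c, 'f, 'p) struc \<Rightarrow> (nat \<Rightarrow> 'u) \<Rightarrow> ('c, 'f, 'p) fm \<Rightarrow> bool" where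
  "sat M s (Pred P ts) \<longleftrightarrow> map (val M s) ts \<in> PredI M P"
| "sat M s (Eq t u) \<longleftrightarrow> val M s t = val M s u"
| "sat M s (Exi t) \<longleftrightarrow> val M s t \<in> Inner M"
| "sat M s (Neg A) \<longleftrightarrow> \<not> sat M s A"
| "sat M s (Imp A B) \<longleftrightarrow> (sat M s A \<longrightarrow> sat M s B)"
| "sat M s (All x A) \<longleftrightarrow> (\<forall>d \<in> Inner M. sat M (s(x := d)) A)"
| "sat M s (Iota x A B) \<longleftrightarrow>
     (\<exists>d \<in> Dom M. sat M (s(x := d)) A \<and>
        (\<forall>e \<in> Dom M. e \<noteq> d \<longrightarrow> \<not> sat M (s(x := e)) A) \<and> sat M (s(x := d)) B)"

text \<open>
  Validity over all structures whose domain is a nonempty set, of any size (finite ones included), of elements of \<open>'u\<close>.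
\<close>

definition valid ::
  "'u itself \<Rightarrow> ('c, 'f, 'p) lang \<Rightarrow> ('c, 'f, 'p) fm set \<Rightarrow> ('c, 'f, 'p) fm set \<Rightarrow> bool"
where
  "valid U L \<Gamma> \<Delta> \<longleftrightarrow>
     (\<forall>(M :: ('u, 'c, 'f, 'p) struc) s.
        is_struc L M \<and> (\<forall>x. s x \<in> Dom M) \<longrightarrow>
        (\<forall>A \<in> \<Gamma>. sat M s A) \<longrightarrow> (\<exists>B \<in> \<Delta>. sat M s B))"

end

theory Submission imports Defs "HOL-Library.Countable_Set" begin

text \<open>
  A Henkin construction whose witnesses are variables. Only finitely many symbols and bound
  variables occur in an underivable sequent; the variables that are not bound in it are free for
  substitution into all formulas whose bound variables are, so no renaming of bound variables is
  needed. Since \<open>Ix[x=t,x=t]\<close> is derivable for every term \<open>t\<close>, each term can be given such a variable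
  as a name, and the quantifiers need to be instantiated only with these variables. In the limit the
  classes of variables under provable identity form a countermodel, which is countable and hence
  embeds into any infinite type.
\<close>

section \<open>Syntax\<close>

fun bvars :: "('c, 'f, 'p) fm \<Rightarrow> nat set" where
  "bvars (Neg A) = bvars A"
| "bvars (Imp A B) = bvars A \<union> bvars B"
| "bvars (All x A) = insert x (bvars A)"
| "bvars (Iota x A B) = insert x (bvars A \<union> bvars B)"
| "bvars _ = {}"

lemma finite_bvars: "finite (bvars A)"
  by (induction A) auto

lemma bvars_subst: "bvars (subst A x t) = bvars A"
  by (induction A) auto

lemma free_for_bvars: "y \<notin> bvars A \<Longrightarrow> free_for (Var y) x A"
  by (induction A) auto

lemma size_subst_tm_Var: "size (subst_tm u x (Var y)) = size u"
proof (induction u)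
  case (Fun f us)
  then show ?case by (simp add: size_list_conv_sum_list comp_def cong: map_cong)
qed auto

text \<open>An instance \<open>subst A x (Var y)\<close> of the body of a quantifier is in general
  not a subformula. Equal size lets the induction in \<open>sat_model\<close> reach it.\<close>

lemma size_subst_Var: "size (subst A x (Var y)) = size A"
  by (induction A) (auto simp: size_subst_tm_Var size_list_conv_sum_list comp_def)

lemma is_tm_subst_tm: "is_tm L u \<Longrightarrow> is_tm L t \<Longrightarrow> is_tm L (subst_tm u x t)"
  by (induction u) auto

lemma is_fm_subst: "is_fm L A \<Longrightarrow> is_tm L t \<Longrightarrow> is_fm L (subst A x t)"
  by (induction A) (auto intro: is_tm_subst_tm)

lemma subst_tm_fresh: "Var x \<notin> subterms u \<Longrightarrow> subst_tm u x t = u"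
  by (induction u) (auto intro: map_idI)

lemma finite_Var_subterms: "finite {x. Var x \<in> subterms t}"
  by (induction t) (auto simp: Collect_disj_eq Collect_bex_eq)

lemma finite_Var_occurs: "finite {x. occurs (Var x) A}"
  by (induction A) (auto simp: Collect_disj_eq Collect_bex_eq finite_Var_subterms)

lemma ex_fresh:
  assumes "finite B" "finite S" "finite T"
  obtains a where "a \<notin> B" "\<forall>A \<in> S. \<not> occurs (Var a) A" "\<forall>t \<in> T. Var a \<notin> subterms t"
proof -
  have "finite (B \<union> (\<Union>A \<in> S. {x. occurs (Var x) A}) \<union> (\<Union>t \<in> T. {x. Var x \<in> subterms t}))"
    using assms by (simp add: finite_Var_occurs finite_Var_subterms)
  from ex_new_if_finite[OF infinite_UNIV_nat this] obtain a where
    "a \<notin> B \<union> (\<Union>A \<in> S. {x. occurs (Var x) A}) \<union> (\<Union>t \<in> T. {x. Var x \<in> subterms t})" ..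
  then show thesis using that[of a] by auto
qed

text \<open>Keeping only the symbols of one sequent makes terms and formulas countable even when the
  language \<open>L\<close> is not. Derivations are still taken in \<open>L\<close>.\<close>

definition restrict_lang ::
  "('c, 'f, 'p) lang \<Rightarrow> 'c set \<Rightarrow> 'f set \<Rightarrow> 'p set \<Rightarrow> ('c, 'f, 'p) lang" where
  "restrict_lang L C F P =
     \<lparr>csym = csym L \<inter> C, farity = farity L |` F, parity = parity L |` P\<rparr>"

lemma is_tm_restrict_lang:
  "is_tm (restrict_lang L C F P) t \<longleftrightarrow> is_tm L t \<and> set1_tm t \<subseteq> C \<and> set2_tm t \<subseteq> F"
  by (induction t) (auto simp: restrict_lang_def restrict_map_def)

lemma is_fm_restrict_lang:
  "is_fm (restrict_lang L C F P) A \<longleftrightarrow>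
     is_fm L A \<and> set1_fm A \<subseteq> C \<and> set2_fm A \<subseteq> F \<and> set3_fm A \<subseteq> P"
  by (induction A)
    (auto simp: is_tm_restrict_lang,
     auto simp: restrict_lang_def restrict_map_def split: if_splits)

section \<open>Countability of terms and formulas over countable symbol sets\<close>

instance tm :: (countable, countable) countable
  by countable_datatype

instance fm :: (countable, countable, countable) countable
  by countable_datatype

text \<open>Renaming symbols by \<open>to_nat_on\<close> is injective on these terms and lands in
  terms over \<open>nat\<close>, which form a countable type.\<close>

lemma countable_tms:
  assumes "countable C" "countable F"
  shows "countable {t. set1_tm t \<subseteq> C \<and> set2_tm t \<subseteq> F}"
proof (rule countableI'[where f = "to_nat \<circ> map_tm (to_nat_on C) (to_nat_on F)"],
    rule comp_inj_on[OF _ inj_on_subset[OF inj_to_nat]])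
  show "inj_on (map_tm (to_nat_on C) (to_nat_on F)) {t. set1_tm t \<subseteq> C \<and> set2_tm t \<subseteq> F}"
    by (rule inj_onI, rule tm.inj_map_strong)
      (use inj_on_to_nat_on[OF assms(1)] inj_on_to_nat_on[OF assms(2)]
       in \<open>auto dest: inj_onD\<close>)
qed simp

lemma countable_fms:
  assumes "countable C" "countable F" "countable P"
  shows "countable {A. set1_fm A \<subseteq> C \<and> set2_fm A \<subseteq> F \<and> set3_fm A \<subseteq> P}"
proof (rule countableI'[where f = "to_nat \<circ> map_fm (to_nat_on C) (to_nat_on F) (to_nat_on P)"],
    rule comp_inj_on[OF _ inj_on_subset[OF inj_to_nat]])
  show "inj_on (map_fm (to_nat_on C) (to_nat_on F) (to_nat_on P))
      {A. set1_fm A \<subseteq> C \<and> set2_fm A \<subseteq> F \<and> set3_fm A \<subseteq> P}"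
    by (rule inj_onI, rule fm.inj_map_strong)
      (use inj_on_to_nat_on[OF assms(1)] inj_on_to_nat_on[OF assms(2)] inj_on_to_nat_on[OF assms(3)]
       in \<open>auto dest: inj_onD\<close>)
qed simp

section \<open>Substitution in structures\<close>

lemma val_subst_tm: "val M s (subst_tm u x t) = val M (s(x := val M s t)) u"
  by (induction u) (auto simp: comp_def cong: map_cong)

text \<open>No binder of \<open>A\<close> captures \<open>y\<close>, so under a binder other than
  \<open>x\<close> the value of \<open>y\<close> is unchanged and the two updates of the assignment
  commute.\<close>

lemma sat_subst_Var:
  "y \<notin> bvars A \<Longrightarrow> sat M s (subst A x (Var y)) \<longleftrightarrow> sat M (s(x := s y)) A"
proof (induction A arbitrary: s)
  case (All z A)
  show ?case
  proof (cases "z = x")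
    case False
    have "sat M (s(z := e)) (subst A x (Var y)) \<longleftrightarrow> sat M (s(x := s y, z := e)) A" for e
      using All.IH[of "s(z := e)"] All.prems False
      by (metis bvars.simps(3) fun_upd_other fun_upd_twist insertCI)
    then show ?thesis by (simp only: subst.simps sat.simps False if_False)
  qed (simp only: subst.simps sat.simps fun_upd_upd simp_thms if_True)
next
  case (Iota z A B)
  show ?case
  proof (cases "z = x")
    case False
    have "sat M (s(z := e)) (subst A x (Var y)) \<longleftrightarrow> sat M (s(x := s y, z := e)) A"
      "sat M (s(z := e)) (subst B x (Var y)) \<longleftrightarrow> sat M (s(x := s y, z := e)) B" for e
      using Iota.IH[of "s(z := e)"] Iota.prems False
      by (metis bvars.simps(4) fun_upd_other fun_upd_twist insertCI UnCI)+
    then show ?thesis by (simp only: subst.simps sat.simps False if_False)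
  qed (simp only: subst.simps sat.simps fun_upd_upd simp_thms if_True)
qed (auto simp: val_subst_tm comp_def)

section \<open>Derivations\<close>

lemma derivable_finite: "derivable L \<Gamma> \<Delta> \<Longrightarrow> finite \<Gamma> \<and> finite \<Delta>"
  by (induction rule: derivable.induct) auto

lemma LW_set: "finite S \<Longrightarrow> derivable L \<Gamma> \<Delta> \<Longrightarrow> \<forall>A \<in> S. is_fm L A \<Longrightarrow> derivable L (S \<union> \<Gamma>) \<Delta>"
  by (induction rule: finite_induct) (auto intro: LW)

lemma RW_set: "finite S \<Longrightarrow> derivable L \<Gamma> \<Delta> \<Longrightarrow> \<forall>A \<in> S. is_fm L A \<Longrightarrow> derivable L \<Gamma> (S \<union> \<Delta>)"
  by (induction rule: finite_induct) (auto intro: RW)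

lemma derivable_mono:
  assumes "derivable L G D" "G \<subseteq> \<Gamma>" "D \<subseteq> \<Delta>" "finite \<Gamma>" "finite \<Delta>" "\<forall>A \<in> \<Gamma> \<union> \<Delta>. is_fm L A"
  shows "derivable L \<Gamma> \<Delta>"
proof -
  have "derivable L (\<Gamma> \<union> G) (\<Delta> \<union> D)"
    using assms by (intro LW_set RW_set) auto
  then show ?thesis using assms by (simp add: Un_absorb2)
qed

lemma Eq_refl_derivable: "is_tm L t \<Longrightarrow> derivable L {} {Eq t t}"
  using EqRefl[of L t "{}"] Ax[of L "Eq t t"] by simp

lemma Eq_subst_derivable:
  assumes "is_tm L t" "is_tm L u" "atomic A" "is_fm L (subst A x u)"
  shows "derivable L {Eq t u, subst A x t} {subst A x u}"
  using LEq[of L A x u "{}" "{subst A x u}" t] Ax[OF assms(4)] assms by simp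

text \<open>
  The sequent \<open>\<Rightarrow> Ix[x=t,x=t]\<close> is derivable for every term \<open>t\<close>, existing or not, so a cut against
  \<open>LI1\<close> introduces a new variable as a name for \<open>t\<close>.
\<close>

lemma derivable_name:
  fixes \<Gamma> \<Delta> :: "('c, 'f, 'p) fm set"
  assumes d: "derivable L (insert (Eq (Var a) t) \<Gamma>) \<Delta>"
    and t: "is_tm L t" and a: "Var a \<notin> subterms t" and fresh: "\<forall>A \<in> \<Gamma> \<union> \<Delta>. \<not> occurs (Var a) A"
  shows "derivable L \<Gamma> \<Delta>"
proof -
  \<comment> \<open>The choice of \<open>x\<close> makes every instance of \<open>E\<close> equal to
    \<open>Eq u t\<close> and keeps \<open>Var a\<close> out of \<open>Iota x E E\<close>, as the
    eigen-term conditions demand.\<close>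
  obtain x where x: "x \<noteq> a" "Var x \<notin> subterms t"
    using ex_fresh[of "{a}" "{}" "{t}"] by auto
  define E :: "('c, 'f, 'p) fm" where "E = Eq (Var x) t"
  have E: "subst E x u = Eq u t" for u
    using x by (simp add: E_def subst_tm_fresh)
  have e: "eigen (Var a) (insert (Iota x E E) S) \<longleftrightarrow> (\<forall>A \<in> S. \<not> occurs (Var a) A)" for S
    using x a by (auto simp: eigen_def E_def)
  have "derivable L {} (insert (Iota x E E) {})"
  proof (rule RI[where t = t and a = "Var a"])
    show "derivable L (insert (subst E x (Var a)) {}) (insert (Eq (Var a) t) {})"
      using t by (auto simp: E intro: Ax)
  qed (use t a e[of "{}"] in \<open>auto simp: E Eq_refl_derivable\<close>, auto simp: E_def)
  moreover have "derivable L (insert (Iota x E E) \<Gamma>) \<Delta>"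
    \<comment> \<open>Both side formulas of \<open>LI1\<close> are \<open>Eq (Var a) t\<close> and
      coincide in the set, leaving exactly the premise \<open>d\<close>.\<close>
    using d fresh by (intro LI1[where a = "Var a"]) (auto simp: E e)
  ultimately show ?thesis using Cut[of L "{}" "Iota x E E" "{}" \<Gamma> \<Delta>] by simp
qed

section \<open>The model of a saturated set\<close>

text \<open>
  \<open>B\<close> collects the variables that may be bound. The remaining ones serve as witnesses, and they are
  free for every variable in every formula of \<open>forms L B\<close>.
\<close>

definition forms :: "('c, 'f, 'p) lang \<Rightarrow> nat set \<Rightarrow> ('c, 'f, 'p) fm set" where
  "forms L B = {A. is_fm L A \<and> bvars A \<subseteq> B}"

lemma forms_simps [simp]:
  "Pred P ts \<in> forms L B \<longleftrightarrow> parity L P = Some (length ts) \<and> (\<forall>t \<in> set ts. is_tm L t)"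
  "Eq t u \<in> forms L B \<longleftrightarrow> is_tm L t \<and> is_tm L u"
  "Exi t \<in> forms L B \<longleftrightarrow> is_tm L t"
  "Neg A \<in> forms L B \<longleftrightarrow> A \<in> forms L B"
  "Imp A A' \<in> forms L B \<longleftrightarrow> A \<in> forms L B \<and> A' \<in> forms L B"
  "All x A \<in> forms L B \<longleftrightarrow> x \<in> B \<and> A \<in> forms L B"
  "Iota x A A' \<in> forms L B \<longleftrightarrow> x \<in> B \<and> A \<in> forms L B \<and> A' \<in> forms L B"
  by (auto simp: forms_def)

lemma forms_subst: "A \<in> forms L B \<Longrightarrow> is_tm L t \<Longrightarrow> subst A x t \<in> forms L B"
  by (auto simp: forms_def bvars_subst is_fm_subst)

lemma forms_is_fm: "A \<in> forms (restrict_lang L C F P) B \<Longrightarrow> is_fm L A"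
  by (simp add: forms_def is_fm_restrict_lang)

text \<open>
  \<open>settled B A h t \<Gamma> \<Delta>\<close>: \<open>A\<close> has been put on one side and has the witnesses which that side demands,
  and \<open>t\<close> has a name. A description on the right needs a witness for each candidate \<open>h\<close>.
\<close>

definition settled ::
  "nat set \<Rightarrow> ('c, 'f, 'p) fm \<Rightarrow> nat \<Rightarrow> ('c, 'f) tm \<Rightarrow>
   ('c, 'f, 'p) fm set \<Rightarrow> ('c, 'f, 'p) fm set \<Rightarrow> bool" where
  "settled B A h t \<Gamma> \<Delta> \<longleftrightarrow>
     (A \<in> \<Gamma> \<or> A \<in> \<Delta>) \<and>
     (\<forall>x C. A = All x C \<longrightarrow> A \<in> \<Delta> \<longrightarrow>
        (\<exists>a. a \<notin> B \<and> Exi (Var a) \<in> \<Gamma> \<and> subst C x (Var a) \<in> \<Delta>)) \<and>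
     (\<forall>x C D. A = Iota x C D \<longrightarrow> A \<in> \<Gamma> \<longrightarrow>
        (\<exists>a. a \<notin> B \<and> subst C x (Var a) \<in> \<Gamma> \<and> subst D x (Var a) \<in> \<Gamma>)) \<and>
     (\<forall>x C D. A = Iota x C D \<longrightarrow> A \<in> \<Delta> \<longrightarrow>
        subst C x (Var h) \<in> \<Delta> \<or> subst D x (Var h) \<in> \<Delta> \<or>
        (\<exists>a. a \<notin> B \<and> subst C x (Var a) \<in> \<Gamma> \<and> Eq (Var a) (Var h) \<in> \<Delta>)) \<and>
     (\<exists>a. a \<notin> B \<and> Eq (Var a) t \<in> \<Gamma>)"

text \<open>Derivable sequents are finite, so consistency of the possibly infinite pair is expressed
  through its derivable subsequents. All but finitely many variables are available as
  witnesses.\<close>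

locale saturated =
  fixes L :: "('c, 'f, 'p) lang"
    and C :: "'c set" and F :: "'f set" and P :: "'p set" and B :: "nat set"
    and \<Phi> \<Psi> :: "('c, 'f, 'p) fm set"
  assumes consistent: "derivable L G D \<Longrightarrow> G \<subseteq> \<Phi> \<Longrightarrow> D \<subseteq> \<Psi> \<Longrightarrow> False"
    and sub: "\<Phi> \<union> \<Psi> \<subseteq> forms (restrict_lang L C F P) B"
    and settled: "A \<in> forms (restrict_lang L C F P) B \<Longrightarrow> h \<notin> B \<Longrightarrow>
      is_tm (restrict_lang L C F P) t \<Longrightarrow> settled B A h t \<Phi> \<Psi>"
    and cofinite: "finite B"
begin

abbreviation "L0 \<equiv> restrict_lang L C F P"

lemma ex_witness_var: "\<exists>h. h \<notin> B"
  using cofinite ex_new_if_finite infinite_UNIV_nat by blast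

lemma decided: "A \<in> forms L0 B \<Longrightarrow> A \<in> \<Phi> \<or> A \<in> \<Psi>"
  using settled[of A _ "Var 0"] ex_witness_var by (auto simp: settled_def)

text \<open>Otherwise all of \<open>D\<close> would lie in \<open>\<Psi>\<close>, against
  consistency. This turns each derived sequent into a closure property of
  \<open>\<Phi>\<close>.\<close>

lemma closed:
  assumes "derivable L G D" "G \<subseteq> \<Phi>" "D \<subseteq> forms L0 B"
  shows "\<exists>A \<in> D. A \<in> \<Phi>"
  using consistent[OF assms(1,2)] decided assms(3) by blast

lemma right: "A \<in> forms L0 B \<Longrightarrow> A \<in> \<Psi> \<longleftrightarrow> A \<notin> \<Phi>"
  using consistent[OF Ax[of L A]] decided forms_is_fm by blast

lemma named: "is_tm L0 t \<Longrightarrow> \<exists>a. a \<notin> B \<and> Eq (Var a) t \<in> \<Phi>"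
  \<comment> \<open>\<open>Eq t t\<close> is just some formula of the fragment; the name comes from
    the last clause of \<open>settled\<close>.\<close>
  using settled[of "Eq t t" _ t] ex_witness_var by (auto simp: settled_def)

lemma tm_L: "is_tm L0 t \<Longrightarrow> is_tm L t"
  by (simp add: is_tm_restrict_lang)

section \<open>Identity as a congruence on the saturated set\<close>

lemma eq_refl: "is_tm L0 t \<Longrightarrow> Eq t t \<in> \<Phi>"
  using closed[OF Eq_refl_derivable[OF tm_L]] by auto

lemma eq_tms: "Eq t u \<in> \<Phi> \<Longrightarrow> is_tm L0 t \<and> is_tm L0 u"
  using sub by auto

lemma eq_subst:
  assumes "Eq t u \<in> \<Phi>" "subst A x t \<in> \<Phi>" "atomic A" "subst A x u \<in> forms L0 B"
  shows "subst A x u \<in> \<Phi>"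
  using closed[OF Eq_subst_derivable[of L t u A x]] assms eq_tms[OF assms(1)]
    forms_is_fm[OF assms(4)] tm_L by auto

lemma eq_sym:
  assumes "Eq t u \<in> \<Phi>"
  shows "Eq u t \<in> \<Phi>"
proof -
  obtain x where x: "Var x \<notin> subterms t" using ex_fresh[of "{}" "{}" "{t}"] by auto
  show ?thesis
    \<comment> \<open>The pattern marks only the left side of \<open>Eq t t\<close> for replacement,
      since \<open>x\<close> does not occur in \<open>t\<close>.\<close>
    using eq_subst[OF assms, of "Eq (Var x) t" x] x eq_tms[OF assms] eq_refl
    by (simp add: subst_tm_fresh)
qed

lemma eq_trans:
  assumes "Eq t u \<in> \<Phi>" "Eq u v \<in> \<Phi>"
  shows "Eq t v \<in> \<Phi>"
proof -
  obtain x where x: "Var x \<notin> subterms t" using ex_fresh[of "{}" "{}" "{t}"] by auto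
  show ?thesis
    using eq_subst[OF assms(2), of "Eq t (Var x)" x] x assms eq_tms[OF assms(1)] eq_tms[OF assms(2)]
    by (simp add: subst_tm_fresh)
qed

lemma exi_cong:
  assumes "Eq t u \<in> \<Phi>" "Exi t \<in> \<Phi>"
  shows "Exi u \<in> \<Phi>"
  using eq_subst[OF assms(1), of "Exi (Var 0)" 0] assms(2) eq_tms[OF assms(1)] by simp

text \<open>\<open>LEq\<close> replaces one term at a time. The prefix \<open>pre\<close> collects
  the arguments already replaced, and a fresh placeholder marks the next one.\<close>

lemma pred_cong:
  assumes "list_all2 (\<lambda>t u. Eq t u \<in> \<Phi>) ts us" "Pred Q (pre @ ts) \<in> \<Phi>"
  shows "Pred Q (pre @ us) \<in> \<Phi>"
  using assms
proof (induction ts us arbitrary: pre rule: list_all2_induct)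
  case (Cons t ts u us)
  obtain x where x: "\<forall>v \<in> set (pre @ ts). Var x \<notin> subterms v"
    using ex_fresh[of "{}" "{}" "set (pre @ ts)"] by auto
  have [simp]: "map (\<lambda>u. subst_tm u x v) pre = pre" "map (\<lambda>u. subst_tm u x v) ts = ts" for v
    using x by (auto intro!: map_idI subst_tm_fresh)
  have "Pred Q (pre @ u # ts) \<in> \<Phi>"
    using eq_subst[OF Cons.hyps(1), of "Pred Q (pre @ Var x # ts)" x] Cons.prems sub
      eq_tms[OF Cons.hyps(1)] by auto
  then show ?case using Cons.IH[of "pre @ [u]"] by simp
qed simp

text \<open>The identity \<open>Eq v (Fun f ...)\<close> with \<open>v\<close> fixed serves as the
  atomic context in which the arguments are replaced one by one.\<close>

lemma fun_cong:
  assumes "list_all2 (\<lambda>t u. Eq t u \<in> \<Phi>) ts us" "Eq v (Fun f (pre @ ts)) \<in> \<Phi>"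
  shows "Eq v (Fun f (pre @ us)) \<in> \<Phi>"
  using assms
proof (induction ts us arbitrary: pre rule: list_all2_induct)
  case (Cons t ts u us)
  obtain x where x: "\<forall>w \<in> set (v # pre @ ts). Var x \<notin> subterms w"
    using ex_fresh[of "{}" "{}" "set (v # pre @ ts)"] by auto
  have [simp]: "map (\<lambda>u. subst_tm u x w) pre = pre" "map (\<lambda>u. subst_tm u x w) ts = ts"
    "subst_tm v x w = v" for w
    using x by (auto intro!: map_idI subst_tm_fresh)
  have "Eq v (Fun f (pre @ u # ts)) \<in> \<Phi>"
    using eq_subst[OF Cons.hyps(1), of "Eq v (Fun f (pre @ Var x # ts))" x] Cons.prems
      eq_tms[OF Cons.hyps(1)] eq_tms[OF Cons.prems] by auto
  then show ?case using Cons.IH[of "pre @ [u]"] by simp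
qed simp

section \<open>Truth conditions of the connectives and quantifiers\<close>

lemma neg_iff: "A \<in> forms L0 B \<Longrightarrow> Neg A \<in> \<Phi> \<longleftrightarrow> A \<notin> \<Phi>"
  using closed[OF RNeg[of L A "{}" "{A}"]] consistent[OF LNeg[of L "{A}" A "{}"]]
    Ax[OF forms_is_fm] by fastforce

lemma imp_iff:
  assumes "A \<in> forms L0 B" "A' \<in> forms L0 B"
  shows "Imp A A' \<in> \<Phi> \<longleftrightarrow> (A \<in> \<Phi> \<longrightarrow> A' \<in> \<Phi>)"
proof -
  have fm: "is_fm L A" "is_fm L A'" using assms by (auto dest: forms_is_fm)
  have AA: "derivable L {A} {A', A}" "derivable L {A, A'} {A'}"
    using RW[OF Ax[OF fm(1)] fm(2)] LW[OF Ax[OF fm(2)] fm(1)] by auto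
  \<comment> \<open>This sequent gives the forward direction; the next two cover a false antecedent
    and a true consequent.\<close>
  have "derivable L {Imp A A', A} {A'}"
    using LImp[of L "{A}" A "{A'}" A'] AA by (simp add: insert_commute)
  moreover have "derivable L {} {Imp A A', A}"
    using RImp[of L A "{}" A' "{A}"] AA by simp
  moreover have "derivable L {A'} {Imp A A'}"
    using RImp[of L A "{A'}" A' "{}"] AA by simp
  ultimately show ?thesis
    using closed[of "{Imp A A', A}" "{A'}"] closed[of "{}" "{Imp A A', A}"]
      closed[of "{A'}" "{Imp A A'}"] assms by auto
qed

text \<open>Forward is \<open>LAll\<close>, as a variable outside \<open>B\<close> is free for
  \<open>x\<close> in \<open>A\<close>. Backward uses the witness that \<open>settled\<close>
  supplies for a universal formula on the right.\<close>

lemma all_iff: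
  assumes "All x A \<in> forms L0 B"
  shows "All x A \<in> \<Phi> \<longleftrightarrow> (\<forall>a. a \<notin> B \<longrightarrow> Exi (Var a) \<in> \<Phi> \<longrightarrow> subst A x (Var a) \<in> \<Phi>)"
proof (intro iffI allI impI)
  fix a assume *: "All x A \<in> \<Phi>" "a \<notin> B" "Exi (Var a) \<in> \<Phi>"
  have K: "subst A x (Var a) \<in> forms L0 B" using assms by (simp add: forms_subst)
  have "free_for (Var a) x A" using assms *(2) by (auto simp: forms_def intro: free_for_bvars)
  then have "derivable L {Exi (Var a), All x A} {subst A x (Var a)}"
    using LAll[of L A x "Var a" "{}"] Ax[OF forms_is_fm[OF K]] by simp
  from closed[OF this] show "subst A x (Var a) \<in> \<Phi>" using * K by auto
next
  assume *: "\<forall>a. a \<notin> B \<longrightarrow> Exi (Var a) \<in> \<Phi> \<longrightarrow> subst A x (Var a) \<in> \<Phi>"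
  show "All x A \<in> \<Phi>"
  proof (rule ccontr)
    assume "All x A \<notin> \<Phi>"
    then obtain a where a: "a \<notin> B" "Exi (Var a) \<in> \<Phi>" "subst A x (Var a) \<in> \<Psi>"
      using settled[OF assms, of _ "Var 0"] ex_witness_var right[OF assms] by (auto simp: settled_def)
    then show False using * right[of "subst A x (Var a)"] sub by auto
  qed
qed

text \<open>Forward, existence comes from the witness for a description on the left and uniqueness
  from \<open>LI2\<close>. Backward, a description on the right would refute one of the three
  conditions for the candidate \<open>h\<close>.\<close>

lemma iota_iff:
  assumes K: "Iota x A A' \<in> forms L0 B"
  shows "Iota x A A' \<in> \<Phi> \<longleftrightarrow>
    (\<exists>h. h \<notin> B \<and> subst A x (Var h) \<in> \<Phi> \<and> subst A' x (Var h) \<in> \<Phi> \<and>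
      (\<forall>a. a \<notin> B \<longrightarrow> subst A x (Var a) \<in> \<Phi> \<longrightarrow> Eq (Var a) (Var h) \<in> \<Phi>))"
    (is "_ \<longleftrightarrow> ?R")
proof
  assume *: "Iota x A A' \<in> \<Phi>"
  then obtain h where h: "h \<notin> B" "subst A x (Var h) \<in> \<Phi>" "subst A' x (Var h) \<in> \<Phi>"
    using settled[OF K, of _ "Var 0"] ex_witness_var by (auto simp: settled_def)
  have "Eq (Var a) (Var h) \<in> \<Phi>" if a: "a \<notin> B" "subst A x (Var a) \<in> \<Phi>" for a
  proof -
    define G where "G = {subst A x (Var a), subst A x (Var h)}"
    have G: "finite G" "\<forall>C \<in> G. is_fm L C" "G \<subseteq> \<Phi>"
      using h a sub forms_is_fm[of _ L C F P B] by (auto simp: G_def subset_iff)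
    \<comment> \<open>In \<open>LI2\<close> the atomic formula is \<open>Eq (Var y) (Var h)\<close>:
      at \<open>Var h\<close> it is reflexivity, at \<open>Var a\<close> the identity
      sought.\<close>
    obtain y where y: "y \<noteq> h" using ex_fresh[of "{h}" "{}" "{}"] by auto
    have "derivable L G (insert (subst A x (Var v)) {})" if "v = a \<or> v = h" for v
      using that G by (intro derivable_mono[OF Ax[of L "subst A x (Var v)"]]) (auto simp: G_def)
    moreover have "derivable L G (insert (subst (Eq (Var y) (Var h)) y (Var h)) {})"
      using y G by (intro derivable_mono[OF Eq_refl_derivable[of L "Var h"]]) auto
    moreover have "free_for (Var v) x A" if "v \<notin> B" for v
      using K that by (auto simp: forms_def intro: free_for_bvars)
    moreover have "is_fm L A'" using K by (auto intro: forms_is_fm)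
    ultimately have "derivable L (insert (Iota x A A') G) {subst (Eq (Var y) (Var h)) y (Var a)}"
      using h(1) a(1) by (intro LI2[where ?t\<^sub>2.0 = "Var h"]) auto
    from closed[OF this] show ?thesis using y * G by auto
  qed
  then show ?R using h by blast
next
  assume ?R
  then obtain h where h: "h \<notin> B" "subst A x (Var h) \<in> \<Phi>" "subst A' x (Var h) \<in> \<Phi>"
    and uniq: "\<And>a. a \<notin> B \<Longrightarrow> subst A x (Var a) \<in> \<Phi> \<Longrightarrow> Eq (Var a) (Var h) \<in> \<Phi>" by blast
  show "Iota x A A' \<in> \<Phi>"
  proof (rule ccontr)
    assume "Iota x A A' \<notin> \<Phi>"
    then have "subst A x (Var h) \<in> \<Psi> \<or> subst A' x (Var h) \<in> \<Psi> \<or>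
        (\<exists>a. a \<notin> B \<and> subst A x (Var a) \<in> \<Phi> \<and> Eq (Var a) (Var h) \<in> \<Psi>)"
      using settled[OF K h(1), of "Var 0"] right[OF K] by (auto simp: settled_def)
    then show False using h uniq right sub by blast
  qed
qed

end

text \<open>An element of the model is the code \<open>\<iota> w\<close> of the least witness variable \<open>w\<close> in its class.\<close>

locale saturated_model = saturated +
  fixes \<iota> :: "nat \<Rightarrow> 'u"
  assumes inj_code: "inj \<iota>"
begin

section \<open>The countermodel on classes of witness variables\<close>

definition cl :: "('a, 'b) tm \<Rightarrow> 'u" where
  "cl t = \<iota> (LEAST w. w \<notin> B \<and> Eq (Var w) t \<in> \<Phi>)"

text \<open>Equal codes mean a common least name, and symmetry and transitivity link the two terms
  through it. Conversely, identical terms have the same names.\<close>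

lemma cl_eq_iff:
  assumes "is_tm L0 t" "is_tm L0 u"
  shows "cl t = cl u \<longleftrightarrow> Eq t u \<in> \<Phi>"
proof
  assume "cl t = cl u"
  then have "(LEAST w. w \<notin> B \<and> Eq (Var w) t \<in> \<Phi>) = (LEAST w. w \<notin> B \<and> Eq (Var w) u \<in> \<Phi>)"
    using inj_code by (auto simp: cl_def dest: injD)
  then obtain w where "Eq (Var w) t \<in> \<Phi>" "Eq (Var w) u \<in> \<Phi>"
    using LeastI_ex[OF named[OF assms(1)]] LeastI_ex[OF named[OF assms(2)]] by auto
  then show "Eq t u \<in> \<Phi>" using eq_sym eq_trans by blast
next
  assume "Eq t u \<in> \<Phi>"
  then have "Eq v t \<in> \<Phi> \<longleftrightarrow> Eq v u \<in> \<Phi>" for v using eq_sym eq_trans by blast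
  then show "cl t = cl u" by (simp add: cl_def)
qed

text \<open>Quantification over the domain thereby reduces to witness variables, the form in which
  \<open>all_iff\<close> and \<open>iota_iff\<close> are stated.\<close>

lemma cl_witness: "is_tm L0 t \<Longrightarrow> \<exists>a. a \<notin> B \<and> cl t = cl (Var a)"
  using named cl_eq_iff eq_sym eq_tms by metis

lemma map_cl_eq_iff:
  assumes "\<forall>t \<in> set ts. is_tm L0 t" "\<forall>t \<in> set us. is_tm L0 t"
  shows "map cl ts = map cl us \<longleftrightarrow> list_all2 (\<lambda>t u. Eq t u \<in> \<Phi>) ts us"
  using assms
proof (induction ts arbitrary: us)
  case (Cons t ts)
  then show ?case by (cases us) (auto simp: cl_eq_iff)
qed auto

text \<open>The structure must interpret all of \<open>L\<close>: outside the fragment, constants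
  and functions take the default \<open>cl (Var 0)\<close> and predicates are empty.
  \<open>SOME\<close> picks representatives of the arguments.\<close>

definition model :: "('u, 'a, 'b, 'c) struc" where
  "model =
     \<lparr>Dom = cl ` {t. is_tm L0 t},
      Inner = cl ` {t. Exi t \<in> \<Phi>},
      ConI = (\<lambda>c. if is_tm L0 (Con c) then cl (Con c) else cl (Var 0)),
      FunI = (\<lambda>f ds. if \<exists>ts. is_tm L0 (Fun f ts) \<and> map cl ts = ds
        then cl (Fun f (SOME ts. is_tm L0 (Fun f ts) \<and> map cl ts = ds)) else cl (Var 0)),
      PredI = (\<lambda>Q. map cl ` {ts. Pred Q ts \<in> \<Phi>})\<rparr>"

text \<open>The chosen arguments are provably identical to \<open>ts\<close> place by place, so
  \<open>fun_cong\<close>, started from reflexivity, makes the choice immaterial.\<close>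

lemma FunI_model:
  assumes "is_tm L0 (Fun f ts)"
  shows "FunI model f (map cl ts) = cl (Fun f ts)"
proof -
  define us where "us = (SOME us. is_tm L0 (Fun f us) \<and> map cl us = map cl ts)"
  have us: "is_tm L0 (Fun f us)" "map cl us = map cl ts"
    using someI[of "\<lambda>us. is_tm L0 (Fun f us) \<and> map cl us = map cl ts" ts] assms
    by (auto simp: us_def)
  then have "list_all2 (\<lambda>t u. Eq t u \<in> \<Phi>) us ts"
    using assms map_cl_eq_iff[of us ts] by auto
  then have "Eq (Fun f us) (Fun f ts) \<in> \<Phi>"
    using fun_cong[of us ts _ f "[]"] eq_refl[OF us(1)] by simp
  then have "cl (Fun f us) = cl (Fun f ts)" using cl_eq_iff us(1) assms by blast
  then show ?thesis using assms by (auto simp: model_def us_def)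
qed

lemma is_struc_model: "is_struc L model"
  unfolding is_struc_def
proof (intro conjI allI impI ballI)
  have v: "cl (Var x) \<in> Dom model" for x by (simp add: model_def)
  show "Dom model \<noteq> {}" using v by blast
  show "Inner model \<subseteq> Dom model" using sub by (auto simp: model_def)
  show "ConI model c \<in> Dom model" for c using v by (auto simp: model_def)
  show "FunI model f ds \<in> Dom model" for f ds
  proof (cases "\<exists>ts. is_tm L0 (Fun f ts) \<and> map cl ts = ds")
    case True
    then obtain ts where "is_tm L0 (Fun f ts)" "map cl ts = ds" by blast
    then have "FunI model f ds = cl (Fun f ts)" using FunI_model by blast
    then show ?thesis using \<open>is_tm L0 (Fun f ts)\<close> by (simp add: model_def del: is_tm.simps)
  next
    case False
    then show ?thesis using v[of 0] by (auto simp: model_def)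
  qed
  show "PredI model Q \<subseteq> {ds. length ds = n \<and> set ds \<subseteq> Dom model}" if "parity L Q = Some n" for Q n
    using sub that by (force simp: model_def restrict_lang_def restrict_map_def split: if_splits)
qed

abbreviation "asg \<equiv> \<lambda>x. cl (Var x)"

lemma val_model: "is_tm L0 t \<Longrightarrow> val model asg t = cl t"
proof (induction t)
  case (Con c)
  then show ?case by (simp add: model_def)
next
  case (Fun f ts)
  then have "map (val model asg) ts = map cl ts" by simp
  then show ?case using FunI_model[OF Fun.prems] by (simp only: val.simps)
qed simp

lemma Inner_model: "is_tm L0 t \<Longrightarrow> cl t \<in> Inner model \<longleftrightarrow> Exi t \<in> \<Phi>"
proof
  assume t: "is_tm L0 t" and "cl t \<in> Inner model"
  then obtain u where "Exi u \<in> \<Phi>" "cl t = cl u" by (auto simp: model_def)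
  then show "Exi t \<in> \<Phi>" using t cl_eq_iff[of u t] sub exi_cong[of u t] by auto
qed (simp add: model_def)

lemma Dom_model: "Dom model = {cl (Var a) | a. a \<notin> B}"
  using cl_witness by (fastforce simp: model_def)

lemma Inner_model_witness: "d \<in> Inner model \<longleftrightarrow> (\<exists>a. a \<notin> B \<and> Exi (Var a) \<in> \<Phi> \<and> d = cl (Var a))"
proof
  assume d: "d \<in> Inner model"
  then have "d \<in> Dom model" using is_struc_model by (auto simp: is_struc_def)
  then show "\<exists>a. a \<notin> B \<and> Exi (Var a) \<in> \<Phi> \<and> d = cl (Var a)"
    using d Inner_model[of "Var _"] by (auto simp: Dom_model)
qed (use Inner_model in auto)

lemma sat_model: "A \<in> forms L0 B \<Longrightarrow> sat model asg A \<longleftrightarrow> A \<in> \<Phi>"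
proof (induction "size A" arbitrary: A rule: less_induct)
  case less
  \<comment> \<open>Since \<open>cl (Var a)\<close> is the value of \<open>a\<close> under
    \<open>asg\<close>, updating the assignment amounts to substituting \<open>Var a\<close>, which
    is not captured.\<close>
  have inst: "sat model (asg(x := cl (Var a))) C \<longleftrightarrow> subst C x (Var a) \<in> \<Phi>"
    if "size C < size A" "C \<in> forms L0 B" "a \<notin> B" for C x a
  proof -
    have "a \<notin> bvars C" using that by (auto simp: forms_def)
    then have "sat model (asg(x := cl (Var a))) C \<longleftrightarrow> sat model asg (subst C x (Var a))"
      by (simp add: sat_subst_Var)
    also have "\<dots> \<longleftrightarrow> subst C x (Var a) \<in> \<Phi>"
      using that by (intro less.hyps) (auto simp: size_subst_Var forms_subst)
    finally show ?thesis .
  qed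
  show ?case
  proof (cases A)
    case (Pred Q ts)
    have ts: "\<forall>t \<in> set ts. is_tm L0 t" using less.prems Pred by simp
    then have "map (val model asg) ts = map cl ts" by (simp add: val_model)
    moreover have "map cl ts \<in> PredI model Q \<longleftrightarrow> Pred Q ts \<in> \<Phi>"
    proof
      assume "map cl ts \<in> PredI model Q"
      then obtain us where us: "Pred Q us \<in> \<Phi>" "map cl us = map cl ts" by (auto simp: model_def)
      then have "list_all2 (\<lambda>t u. Eq t u \<in> \<Phi>) us ts"
        using ts sub map_cl_eq_iff[of us ts] by auto
      then show "Pred Q ts \<in> \<Phi>" using pred_cong[of us ts Q "[]"] us by simp
    qed (simp add: model_def)
    ultimately show ?thesis by (simp only: Pred sat.simps)
  next
    case (Eq t u)
    then show ?thesis using less.prems by (simp add: val_model cl_eq_iff)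
  next
    case (Exi t)
    then show ?thesis using less.prems by (simp add: val_model Inner_model)
  next
    case (Neg C)
    then show ?thesis using less by (simp add: neg_iff)
  next
    case (Imp C D)
    then show ?thesis using less by (simp add: imp_iff)
  next
    case (All x C)
    have "sat model asg A \<longleftrightarrow>
        (\<forall>a. a \<notin> B \<longrightarrow> Exi (Var a) \<in> \<Phi> \<longrightarrow> sat model (asg(x := cl (Var a))) C)"
      unfolding All sat.simps by (metis Inner_model_witness)
    also have "\<dots> \<longleftrightarrow> (\<forall>a. a \<notin> B \<longrightarrow> Exi (Var a) \<in> \<Phi> \<longrightarrow> subst C x (Var a) \<in> \<Phi>)"
      using inst[of C _ x] less.prems by (auto simp: All)
    finally show ?thesis using all_iff less.prems All by simp
  next
    case (Iota x C D)
    have "sat model asg A \<longleftrightarrow>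
        (\<exists>h. h \<notin> B \<and> sat model (asg(x := cl (Var h))) C \<and> sat model (asg(x := cl (Var h))) D \<and>
          (\<forall>a. a \<notin> B \<longrightarrow> sat model (asg(x := cl (Var a))) C \<longrightarrow> cl (Var a) = cl (Var h)))"
      by (auto simp: Iota Dom_model)
    also have "\<dots> \<longleftrightarrow>
        (\<exists>h. h \<notin> B \<and> subst C x (Var h) \<in> \<Phi> \<and> subst D x (Var h) \<in> \<Phi> \<and>
          (\<forall>a. a \<notin> B \<longrightarrow> subst C x (Var a) \<in> \<Phi> \<longrightarrow> Eq (Var a) (Var h) \<in> \<Phi>))"
      using inst[of C _ x] inst[of D _ x] less.prems by (auto simp: Iota cl_eq_iff)
    finally show ?thesis using iota_iff less.prems Iota by simp
  qed
qed

end

section \<open>Saturation\<close>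

locale witness_setup =
  fixes L :: "('c, 'f, 'p) lang"
    and C :: "'c set" and F :: "'f set" and P :: "'p set" and B :: "nat set"
  assumes finB: "finite B"
begin

abbreviation "K \<equiv> forms (restrict_lang L C F P) B"

section \<open>One-step extensions of an underivable sequent\<close>

definition underivable :: "('c, 'f, 'p) fm set \<times> ('c, 'f, 'p) fm set \<Rightarrow> bool" where
  "underivable S \<longleftrightarrow> finite (fst S) \<and> finite (snd S) \<and> fst S \<union> snd S \<subseteq> K \<and> \<not> derivable L (fst S) (snd S)"

lemma underivable_disjoint: "underivable (\<Gamma>, \<Delta>) \<Longrightarrow> A \<in> \<Gamma> \<Longrightarrow> A \<notin> \<Delta>"
  using derivable_mono[OF Ax[of L A], of \<Gamma> \<Delta>] forms_is_fm[of _ L C F P B]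
  by (auto simp: underivable_def subset_iff)

lemma underivable_decide:
  assumes "underivable (\<Gamma>, \<Delta>)" "A \<in> K"
  shows "underivable (insert A \<Gamma>, \<Delta>) \<or> underivable (\<Gamma>, insert A \<Delta>)"
  using assms Cut[of L \<Gamma> A \<Delta> \<Gamma> \<Delta>] by (auto simp: underivable_def)

lemma underivable_name:
  assumes "underivable (\<Gamma>, \<Delta>)" "is_tm (restrict_lang L C F P) t"
  shows "\<exists>a. a \<notin> B \<and> underivable (insert (Eq (Var a) t) \<Gamma>, \<Delta>)"
proof -
  obtain a where "a \<notin> B" "\<forall>A \<in> \<Gamma> \<union> \<Delta>. \<not> occurs (Var a) A" "Var a \<notin> subterms t"
    using ex_fresh[of B "\<Gamma> \<union> \<Delta>" "{t}"] finB assms by (auto simp: underivable_def)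
  then show ?thesis
    using derivable_name[of L a t \<Gamma> \<Delta>] assms by (auto simp: underivable_def is_tm_restrict_lang)
qed

text \<open>\<open>RAll\<close> read contrapositively. The principal formula already belongs to
  \<open>\<Delta>\<close>, so inserting it changes nothing and it is retained.\<close>

lemma underivable_RAll:
  assumes "underivable (\<Gamma>, \<Delta>)" "All x A \<in> \<Delta>"
  shows "\<exists>a. a \<notin> B \<and> underivable (insert (Exi (Var a)) \<Gamma>, insert (subst A x (Var a)) \<Delta>)"
proof -
  have "All x A \<in> K" using assms by (auto simp: underivable_def)
  obtain a where "a \<notin> B" "\<forall>A \<in> \<Gamma> \<union> \<Delta>. \<not> occurs (Var a) A"
    using ex_fresh[of B "\<Gamma> \<union> \<Delta>" "{}"] finB assms by (auto simp: underivable_def)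
  then show ?thesis
    using RAll[of L "Var a" \<Gamma> A x \<Delta>] assms \<open>All x A \<in> K\<close>
    by (auto simp: underivable_def eigen_def insert_absorb forms_subst)
qed

lemma underivable_LI:
  assumes "underivable (\<Gamma>, \<Delta>)" "Iota x A A' \<in> \<Gamma>"
  shows "\<exists>a. a \<notin> B \<and> underivable (insert (subst A x (Var a)) (insert (subst A' x (Var a)) \<Gamma>), \<Delta>)"
proof -
  have "Iota x A A' \<in> K" using assms by (auto simp: underivable_def)
  obtain a where "a \<notin> B" "\<forall>A \<in> \<Gamma> \<union> \<Delta>. \<not> occurs (Var a) A"
    using ex_fresh[of B "\<Gamma> \<union> \<Delta>" "{}"] finB assms by (auto simp: underivable_def)
  then show ?thesis
    using LI1[of L A x "Var a" A' \<Gamma> \<Delta>] assms \<open>Iota x A A' \<in> K\<close>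
    by (auto simp: underivable_def eigen_def insert_absorb forms_subst)
qed

text \<open>The disjuncts are the three premises of \<open>RI\<close> with \<open>Var h\<close> as
  its term: if the conclusion is underivable, so is one of them.\<close>

lemma underivable_RI:
  assumes "underivable (\<Gamma>, \<Delta>)" "Iota x A A' \<in> \<Delta>" "h \<notin> B"
  shows "underivable (\<Gamma>, insert (subst A x (Var h)) \<Delta>) \<or> underivable (\<Gamma>, insert (subst A' x (Var h)) \<Delta>) \<or>
    (\<exists>a. a \<notin> B \<and> underivable (insert (subst A x (Var a)) \<Gamma>, insert (Eq (Var a) (Var h)) \<Delta>))"
proof -
  have K: "Iota x A A' \<in> K" using assms by (auto simp: underivable_def)
  then have ff: "free_for (Var h) x A" "free_for (Var h) x A'"
    using assms(3) by (auto simp: forms_def intro: free_for_bvars)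
  \<comment> \<open>\<open>a \<noteq> h\<close> is the side condition of \<open>RI\<close> that the
    eigen-term not occur in its term.\<close>
  obtain a where "a \<notin> B" "\<forall>A \<in> \<Gamma> \<union> \<Delta>. \<not> occurs (Var a) A" "a \<noteq> h"
    using ex_fresh[of B "\<Gamma> \<union> \<Delta>" "{Var h}"] finB assms by (auto simp: underivable_def)
  then show ?thesis
    using RI[of L \<Gamma> A x "Var h" \<Delta> A' "Var a"] assms K ff
    by (auto simp: underivable_def eigen_def insert_absorb forms_subst)
qed

text \<open>Underivability survives each of three moves in turn: naming \<open>t\<close>, deciding
  \<open>A\<close>, and adding the witnesses for the side on which \<open>A\<close> was put.\<close>

lemma underivable_settle:
  assumes g: "underivable (\<Gamma>, \<Delta>)" and A: "A \<in> K" and h: "h \<notin> B" and t: "is_tm (restrict_lang L C F P) t"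
  shows "\<exists>\<Gamma>' \<Delta>'. underivable (\<Gamma>', \<Delta>') \<and> \<Gamma> \<subseteq> \<Gamma>' \<and> \<Delta> \<subseteq> \<Delta>' \<and> settled B A h t \<Gamma>' \<Delta>'"
proof -
  obtain a where a: "a \<notin> B" and g1: "underivable (insert (Eq (Var a) t) \<Gamma>, \<Delta>)"
    using underivable_name[OF g t] by blast
  define G where "G = insert (Eq (Var a) t) \<Gamma>"
  have g2: "underivable (G, \<Delta>)" using g1 by (simp add: G_def)
  consider "underivable (insert A G, \<Delta>)" | "underivable (G, insert A \<Delta>)"
    using underivable_decide[OF g2 A] by blast
  then show ?thesis
  proof cases
    case 1
    show ?thesis
    proof (cases "\<exists>x C D. A = Iota x C D")
      case True
      then obtain x C D where Iota: "A = Iota x C D" by blast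
      with underivable_LI[OF 1, of x C D] obtain b where b: "b \<notin> B"
        "underivable (insert (subst C x (Var b)) (insert (subst D x (Var b)) (insert A G)), \<Delta>)" by auto
      then show ?thesis
      proof (intro exI conjI)
        show "underivable (insert (subst C x (Var b)) (insert (subst D x (Var b)) (insert A G)), \<Delta>)"
          by (rule b(2))
      qed (use a b(1) underivable_disjoint[OF b(2), of A] Iota in \<open>auto simp: settled_def G_def\<close>)
    next
      case False
      show ?thesis
      proof (intro exI conjI)
        show "underivable (insert A G, \<Delta>)" by (rule 1)
      qed (use a underivable_disjoint[OF 1, of A] False in \<open>auto simp: settled_def G_def\<close>)
    qed
  next
    case 2
    have settle: ?thesis if "underivable (X, Y)" "G \<subseteq> X" "insert A \<Delta> \<subseteq> Y"
      "\<And>x C. A = All x C \<Longrightarrow> \<exists>a. a \<notin> B \<and> Exi (Var a) \<in> X \<and> subst C x (Var a) \<in> Y"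
      "\<And>x C D. A = Iota x C D \<Longrightarrow> subst C x (Var h) \<in> Y \<or> subst D x (Var h) \<in> Y \<or>
        (\<exists>a. a \<notin> B \<and> subst C x (Var a) \<in> X \<and> Eq (Var a) (Var h) \<in> Y)" for X Y
      using that(1)
    proof (intro exI conjI)
      \<comment> \<open>With \<open>A\<close> on the right, disjointness makes the clause for a
        description on the left vacuous.\<close>
      have "A \<notin> X" using that(3) underivable_disjoint[OF that(1), of A] by auto
      then show "settled B A h t X Y" using that a by (auto simp: settled_def G_def)
    qed (use that in \<open>auto simp: G_def\<close>)
    consider (All) x C where "A = All x C" | (Iota) x C D where "A = Iota x C D"
      | (other) "\<nexists>x C. A = All x C" "\<nexists>x C D. A = Iota x C D" by blast
    then show ?thesis
    proof cases
      case All
      with underivable_RAll[OF 2, of x C] obtain b where b: "b \<notin> B"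
        "underivable (insert (Exi (Var b)) G, insert (subst C x (Var b)) (insert A \<Delta>))" by auto
      show ?thesis by (rule settle[OF b(2)]) (use b(1) All in auto)
    next
      case Iota
      with underivable_RI[OF 2, of x C D h] h consider
        "underivable (G, insert (subst C x (Var h)) (insert A \<Delta>))"
        | "underivable (G, insert (subst D x (Var h)) (insert A \<Delta>))"
        | b where "b \<notin> B"
          "underivable (insert (subst C x (Var b)) G, insert (Eq (Var b) (Var h)) (insert A \<Delta>))"
        by auto
      then show ?thesis
      proof cases
        case 1
        show ?thesis by (rule settle[OF 1]) (use Iota in auto)
      next
        case 2
        show ?thesis by (rule settle[OF 2]) (use Iota in auto)
      next
        case 3
        show ?thesis by (rule settle[OF 3(2)]) (use Iota 3(1) in auto)
      qed
    next
      case other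
      show ?thesis by (rule settle[OF 2]) (use other in auto)
    qed
  qed
qed

end

section \<open>The limit of the extensions\<close>

text \<open>The clauses presuppose the side of \<open>A\<close>, so growth alone could break them.
  Disjointness of the larger pair prevents \<open>A\<close> from appearing on the other
  side.\<close>

lemma settled_mono:
  assumes "settled B A h t \<Gamma> \<Delta>" "\<Gamma> \<subseteq> \<Gamma>'" "\<Delta> \<subseteq> \<Delta>'" "\<Gamma>' \<inter> \<Delta>' = {}"
  shows "settled B A h t \<Gamma>' \<Delta>'"
proof -
  have iffs: "A \<in> \<Gamma> \<longleftrightarrow> A \<in> \<Gamma>'" "A \<in> \<Delta> \<longleftrightarrow> A \<in> \<Delta>'"
    using assms by (auto simp: settled_def)
  show ?thesis
    unfolding settled_def iffs[symmetric]
    using assms(1)[unfolded settled_def] subsetD[OF assms(2)] subsetD[OF assms(3)]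
    by (intro conjI) metis+
qed

lemma (in witness_setup) underivable_saturated:
  assumes underivable0: "underivable (\<Gamma>, \<Delta>)" and fin: "finite C" "finite F" "finite P"
  shows "\<exists>\<Phi> \<Psi>. \<Gamma> \<subseteq> \<Phi> \<and> \<Delta> \<subseteq> \<Psi> \<and> saturated L C F P B \<Phi> \<Psi>"
proof -
  \<comment> \<open>\<open>T\<close> lists the tasks. By \<open>settled_mono\<close> a task met once
    stays met, so an enumeration reaching each task at least once suffices.\<close>
  define T where "T = K \<times> (- B) \<times> {t. is_tm (restrict_lang L C F P) t}"
  have "countable {A. set1_fm A \<subseteq> C \<and> set2_fm A \<subseteq> F \<and> set3_fm A \<subseteq> P}"
    using fin by (intro countable_fms countable_finite)
  then have cK: "countable K"
    by (rule countable_subset[rotated]) (auto simp: forms_def is_fm_restrict_lang)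
  have "countable {t. set1_tm t \<subseteq> C \<and> set2_tm t \<subseteq> F}"
    using fin by (intro countable_tms countable_finite)
  then have ct: "countable {t. is_tm (restrict_lang L C F P) t}"
    by (rule countable_subset[rotated]) (auto simp: is_tm_restrict_lang)
  have cT: "countable T" unfolding T_def using cK ct by (intro countable_SIGMA) auto
  obtain h where "h \<notin> B" using ex_new_if_finite[OF infinite_UNIV_nat finB] by blast
  then have "(Eq (Var 0) (Var 0), h, Var 0) \<in> T" by (simp add: T_def)
  then have neT: "T \<noteq> {}" by blast
  define R where "R n S S' \<longleftrightarrow> fst S \<subseteq> fst S' \<and> snd S \<subseteq> snd S' \<and>
    (case from_nat_into T n of (A, h, t) \<Rightarrow> settled B A h t (fst S') (snd S'))" for n S S'
  \<comment> \<open>Dependent choice builds the chain; the clause for \<open>n = 0\<close> pins its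
    start to the given sequent.\<close>
  have "\<exists>f. \<forall>n. (underivable (f n) \<and> (n = 0 \<longrightarrow> f n = (\<Gamma>, \<Delta>))) \<and> R n (f n) (f (Suc n))"
  proof (rule dependent_nat_choice)
    show "\<exists>y. (underivable y \<and> (Suc n = 0 \<longrightarrow> y = (\<Gamma>, \<Delta>))) \<and> R n x y"
      if "underivable x \<and> (n = 0 \<longrightarrow> x = (\<Gamma>, \<Delta>))" for x n
    proof -
      obtain A h t where e: "from_nat_into T n = (A, h, t)" by (metis prod_cases3)
      then have "(A, h, t) \<in> T" using from_nat_into[OF neT] by metis
      then show ?thesis
        using underivable_settle[of "fst x" "snd x" A h t] that e by (auto simp: T_def R_def)
    qed
  qed (use underivable0 in auto)
  then obtain f where f: "\<And>n. underivable (f n)" "f 0 = (\<Gamma>, \<Delta>)" "\<And>n. R n (f n) (f (Suc n))" by blast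
  define \<Phi> where "\<Phi> = (\<Union>n. fst (f n))"
  define \<Psi> where "\<Psi> = (\<Union>n. snd (f n))"
  have up: "fst (f n) \<subseteq> \<Phi>" "snd (f n) \<subseteq> \<Psi>" for n
    by (auto simp: \<Phi>_def \<Psi>_def)
  have mono: "fst (f m) \<subseteq> fst (f n)" "snd (f m) \<subseteq> snd (f n)" if "m \<le> n" for m n
    using that f(3) lift_Suc_mono_le[of "\<lambda>n. fst (f n)"] lift_Suc_mono_le[of "\<lambda>n. snd (f n)"]
    by (simp_all add: R_def)
  have sub: "\<Phi> \<union> \<Psi> \<subseteq> K" using f(1) by (auto simp: \<Phi>_def \<Psi>_def underivable_def)
  have cons: False if d: "derivable L G D" "G \<subseteq> \<Phi>" "D \<subseteq> \<Psi>" for G D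
  proof -
    have fin: "finite G" "finite D" using derivable_finite[OF d(1)] by auto
    \<comment> \<open>A finite subset of the union of a chain lies in one member, so a derivation
      inside the limit already refutes some stage.\<close>
    have "\<exists>n. X \<subseteq> g n" if "finite X" "X \<subseteq> (\<Union>n. g n)" "mono g"
      for X and g :: "nat \<Rightarrow> ('c, 'f, 'p) fm set"
      using that
    proof (induction rule: finite_induct)
      case (insert A X)
      then obtain n k where "X \<subseteq> g n" "A \<in> g k" by auto
      then have "insert A X \<subseteq> g (max n k)"
        using insert.prems(2) monoD[of g n "max n k"] monoD[of g k "max n k"] by auto
      then show ?case by blast
    qed simp
    from this[OF fin(1) d(2)[unfolded \<Phi>_def]] this[OF fin(2) d(3)[unfolded \<Psi>_def]]
    obtain m n where m: "G \<subseteq> fst (f m)" and n: "D \<subseteq> snd (f n)"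
      using mono by (auto simp: mono_def)
    have "G \<subseteq> fst (f (max m n))" "D \<subseteq> snd (f (max m n))"
      using m n mono[of m "max m n"] mono[of n "max m n"] by auto
    then have "derivable L (fst (f (max m n))) (snd (f (max m n)))"
      using f(1)[of "max m n"] forms_is_fm[of _ L C F P B]
      by (intro derivable_mono[OF d(1)]) (auto simp: underivable_def subset_iff)
    then show False using f(1)[of "max m n"] by (simp add: underivable_def)
  qed
  have "saturated L C F P B \<Phi> \<Psi>"
  proof
    fix A h and t :: "('c, 'f) tm"
    assume "A \<in> K" "h \<notin> B" "is_tm (restrict_lang L C F P) t"
    then have "(A, h, t) \<in> T" by (simp add: T_def)
    then obtain n where "from_nat_into T n = (A, h, t)"
      using from_nat_into_surj[OF cT] by blast
    then have st: "settled B A h t (fst (f (Suc n))) (snd (f (Suc n)))"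
      using f(3)[of n] by (simp add: R_def)
    have "\<Phi> \<inter> \<Psi> = {}"
      using cons[OF Ax] sub forms_is_fm by blast
    then show "settled B A h t \<Phi> \<Psi>"
      by (rule settled_mono[OF st up])
  qed (use sub cons finB in auto)
  moreover have "\<Gamma> \<subseteq> \<Phi>" "\<Delta> \<subseteq> \<Psi>"
    using f(2) up[of 0] by auto
  ultimately show ?thesis by blast
qed

section \<open>From an underivable sequent to a countermodel\<close>

theorem theorem6:
  fixes L :: "('c, 'f, 'p) lang" and \<Gamma> \<Delta> :: "('c, 'f, 'p) fm set"
  assumes "infinite (UNIV :: 'u set)"
    and "finite \<Gamma>" and "finite \<Delta>"
    and "\<forall>A \<in> \<Gamma> \<union> \<Delta>. is_fm L A"
    and "valid TYPE('u) L \<Gamma> \<Delta>"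
  shows "derivable L \<Gamma> \<Delta>"
proof (rule ccontr)
  assume nd: "\<not> derivable L \<Gamma> \<Delta>"
  obtain \<iota> :: "nat \<Rightarrow> 'u" where \<iota>: "inj \<iota>"
    \<comment> \<open>Model elements are coded by natural numbers, so an injection of
      \<open>nat\<close> places the countermodel inside \<open>'u\<close>.\<close>
    using infinite_countable_subset[OF assms(1)] by blast
  define B where "B = (\<Union>A \<in> \<Gamma> \<union> \<Delta>. bvars A)"
  define C where "C = (\<Union>A \<in> \<Gamma> \<union> \<Delta>. set1_fm A)"
  define F where "F = (\<Union>A \<in> \<Gamma> \<union> \<Delta>. set2_fm A)"
  define P where "P = (\<Union>A \<in> \<Gamma> \<union> \<Delta>. set3_fm A)"
  have finite_tm: "finite (set1_tm t) \<and> finite (set2_tm t)" for t :: "('c, 'f) tm"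
    by (induction t) auto
  have finite_fm: "finite (set1_fm A) \<and> finite (set2_fm A) \<and> finite (set3_fm A)"
    for A :: "('c, 'f, 'p) fm"
    by (induction A) (auto simp: finite_tm)
  have fin: "finite B" "finite C" "finite F" "finite P"
    using assms(2,3) finite_fm by (auto simp: B_def C_def F_def P_def finite_bvars)
  interpret witness_setup L C F P B by unfold_locales (rule fin)
  have K: "\<Gamma> \<union> \<Delta> \<subseteq> K"
    using assms(4) by (auto simp: forms_def is_fm_restrict_lang B_def C_def F_def P_def)
  have "underivable (\<Gamma>, \<Delta>)" using nd K assms(2,3) by (simp add: underivable_def)
  from underivable_saturated[OF this fin(2-4)] obtain \<Phi> \<Psi>
    where *: "\<Gamma> \<subseteq> \<Phi>" "\<Delta> \<subseteq> \<Psi>" "saturated L C F P B \<Phi> \<Psi>" by blast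
  interpret saturated_model L C F P B \<Phi> \<Psi> \<iota>
    using *(3) \<iota> by (simp add: saturated_model_def saturated_model_axioms_def)
  have "\<forall>A \<in> \<Gamma>. sat model asg A" using *(1) K sat_model by blast
  moreover have "\<forall>x. asg x \<in> Dom model" by (simp add: model_def)
  ultimately obtain A where "A \<in> \<Delta>" "sat model asg A"
    using assms(5) is_struc_model unfolding valid_def by metis
  then show False using *(2) K sat_model right by blast
qed

end
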